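(* One has $$\vartheta_{\rm adaptive}(S,s)\le\frac{\sqrt s\,\max_{j\notin S}\sqrt{\sum_{k\in S}\sigma_{j,k}^2}}{\Lambda^2(S,s)}\le\vartheta_{\rm mutual}(S):=\frac{s\,\max_{j\notin S}\max_{k\in S}|\sigma_{j,k}|}{\Lambda^2(S,s)} .$$
   Context: $Q$ is a probability measure on a measurable space, $\psi_1,\dots,\psi_p\in L_2(Q)$ are real functions, $(\cdot,\cdot)$ and $\|\cdot\|$ are the inner product and norm of $L_2(Q)$, and $f_\beta:=\sum_{j=1}^p\beta_j\psi_j$ for $\beta\in\mathbb{R}^p$. The Gram matrix is $\Sigma=(\sigma_{j,k})$, $\sigma_{j,k}:=(\psi_j,\psi_k)$. $S\subset\{1,\dots,p\}$ is a nonempty index set, $s:=|S|$. $\beta_{\mathcal N}$ is the vector with entries $\beta_j1\{j\in\mathcal N\}$. $\Lambda^2(S,s)$ is the smallest eigenvalue of $(\sigma_{j,k})_{j,k\in S}$; standing assumption: it is strictly positive. Maxima over an empty set of indices $j\notin S$ are $0$. The adaptive restricted regression is $$\vartheta_{\rm adaptive}(S,s):=\sup\left\{\frac{|(f_{\beta_S},f_{\beta_{S^c}})|}{\|f_{\beta_S}\|^2}:\ \beta\in\mathbb{R}^p,\ \beta_S\ne0,\ \|\beta_{S^c}\|_1\le\sqrt s\,\|\beta_S\|_2\right\}.$$ *)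

theory Defs
  imports
    "HOL-Probability.Probability_Measure"
    "Jordan_Normal_Form.Spectral_Radius"
    "Jordan_Normal_Form.DL_Submatrix"
begin

no_notation vec_nth (infixl "$" 90)

(* The index set {1,...,p} is rendered as {..<p}, as is usual for Matrix.vec and Matrix.mat. *)

definition in_L2 :: "'a measure \<Rightarrow> ('a \<Rightarrow> real) \<Rightarrow> bool" where
  "in_L2 Q f \<longleftrightarrow> f \<in> borel_measurable Q \<and> integrable Q (\<lambda>x. (f x)\<^sup>2)"

definition L2_inner :: "'a measure \<Rightarrow> ('a \<Rightarrow> real) \<Rightarrow> ('a \<Rightarrow> real) \<Rightarrow> real" where
  "L2_inner Q f g = (\<integral>x. f x * g x \<partial>Q)"

definition L2_norm :: "'a measure \<Rightarrow> ('a \<Rightarrow> real) \<Rightarrow> real" where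
  "L2_norm Q f = sqrt (L2_inner Q f f)"

definition lin_comb :: "(nat \<Rightarrow> 'a \<Rightarrow> real) \<Rightarrow> real vec \<Rightarrow> 'a \<Rightarrow> real" where
  "lin_comb \<psi> \<beta> x = (\<Sum>j<dim_vec \<beta>. \<beta> $ j * \<psi> j x)"

definition gram :: "'a measure \<Rightarrow> nat \<Rightarrow> (nat \<Rightarrow> 'a \<Rightarrow> real) \<Rightarrow> real mat" where
  "gram Q p \<psi> = mat p p (\<lambda>(j, k). L2_inner Q (\<psi> j) (\<psi> k))"

definition restrict_vec :: "real vec \<Rightarrow> nat set \<Rightarrow> real vec" where
  "restrict_vec \<beta> N = vec (dim_vec \<beta>) (\<lambda>j. if j \<in> N then \<beta> $ j else 0)"

definition vec_norm1 :: "real vec \<Rightarrow> real" where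
  "vec_norm1 \<beta> = (\<Sum>j<dim_vec \<beta>. \<bar>\<beta> $ j\<bar>)"

definition vec_norm2 :: "real vec \<Rightarrow> real" where
  "vec_norm2 \<beta> = sqrt (\<Sum>j<dim_vec \<beta>. (\<beta> $ j)\<^sup>2)"

(* The matrices concerned are real symmetric and (for S nonempty) nonempty,
   so the real spectrum is finite and nonempty and Min is the smallest eigenvalue. *)
definition Lambda2 :: "'a measure \<Rightarrow> nat \<Rightarrow> (nat \<Rightarrow> 'a \<Rightarrow> real) \<Rightarrow> nat set \<Rightarrow> real" where
  "Lambda2 Q p \<psi> S = Min (spectrum (submatrix (gram Q p \<psi>) S S))"

definition max_over :: "nat set \<Rightarrow> (nat \<Rightarrow> real) \<Rightarrow> real" where
  "max_over A f = (if A = {} then 0 else Max (f ` A))"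

(* Extended-real valued, so that the supremum is meaningful without a priori boundedness. *)
definition theta_adaptive :: "'a measure \<Rightarrow> nat \<Rightarrow> (nat \<Rightarrow> 'a \<Rightarrow> real) \<Rightarrow> nat set \<Rightarrow> ereal" where
  "theta_adaptive Q p \<psi> S =
    Sup {ereal (\<bar>L2_inner Q (lin_comb \<psi> (restrict_vec \<beta> S)) (lin_comb \<psi> (restrict_vec \<beta> ({..<p} - S)))\<bar>
                / (L2_norm Q (lin_comb \<psi> (restrict_vec \<beta> S)))\<^sup>2) | \<beta>.
          \<beta> \<in> carrier_vec p \<and> restrict_vec \<beta> S \<noteq> 0\<^sub>v p \<and>
          vec_norm1 (restrict_vec \<beta> ({..<p} - S)) \<le> sqrt (real (card S)) * vec_norm2 (restrict_vec \<beta> S)}"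

definition theta_mutual :: "'a measure \<Rightarrow> nat \<Rightarrow> (nat \<Rightarrow> 'a \<Rightarrow> real) \<Rightarrow> nat set \<Rightarrow> real" where
  "theta_mutual Q p \<psi> S =
    real (card S) * max_over ({..<p} - S) (\<lambda>j. max_over S (\<lambda>k. \<bar>gram Q p \<psi> $$ (j, k)\<bar>))
      / Lambda2 Q p \<psi> S"

end

theory Submission
  imports Defs
begin

text \<open>
  Since $(f_{\beta_S}, f_{\beta_{S^c}}) = \sum_{j \notin S} \beta_j \sum_{k \in S} \beta_k \sigma_{j,k}$,
  Cauchy--Schwarz in the inner sum bounds the numerator by
  $\|\beta_{S^c}\|_1 \|\beta_S\|_2 \max_j (\sum_{k \in S} \sigma_{j,k}^2)^{1/2}$, and the denominator
  is at least $\Lambda^2(S,s) \|\beta_S\|_2^2$ by the Rayleigh principle. The latter is proved without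
  compactness: if $\mu$ is the infimum of the Rayleigh quotient of a symmetric matrix $A$, then
  $A - \mu I$ is positive semidefinite; were it nonsingular, it would be coercive, and $\mu$ would
  not be the infimum. Hence $\mu$ is an eigenvalue.
\<close>

text \<open>Frees \<open>\<bullet>\<close> from the inner product of real inner product spaces,
  leaving the scalar product of \<open>vec\<close>.\<close>

unbundle no inner_syntax

section \<open>Linear algebra: scalar products, coercivity and the Rayleigh principle\<close>

lemma scalar_prod_self_nonneg: "0 \<le> v \<bullet> (v :: real vec)"
  unfolding scalar_prod_def by (intro sum_nonneg) simp

lemma scalar_prod_self_pos:
  fixes v :: "real vec"
  assumes "v \<in> carrier_vec n" "v \<noteq> 0\<^sub>v n"
  shows "0 < v \<bullet> v"
proof -
  obtain i where i: "i < n" "v $ i \<noteq> 0"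
    using assms by (metis carrier_vecD eq_vecI index_zero_vec)
  have "0 < (\<Sum>i\<in>{0..<n}. v $ i * v $ i)"
    by (rule sum_pos2[of _ i]) (use i in \<open>auto simp: zero_less_mult_iff linorder_neq_iff\<close>)
  then show ?thesis
    using assms(1) by (simp add: scalar_prod_def)
qed

text \<open>Coordinatewise 2ab \<le> a^2 + b^2. It bounds quadratic forms by squared norms, with no
  square roots.\<close>

lemma scalar_prod_le_half_squares:
  fixes v w :: "real vec"
  assumes "v \<in> carrier_vec n" "w \<in> carrier_vec n"
  shows "2 * (v \<bullet> w) \<le> v \<bullet> v + w \<bullet> w"
proof -
  have "2 * (a * b) \<le> a * a + b * b" for a b :: real
    using sum_squares_bound[of a b] by (simp add: power2_eq_square)
  then have "(\<Sum>i<n. 2 * (v $ i * w $ i)) \<le> (\<Sum>i<n. v $ i * v $ i + w $ i * w $ i)"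
    by (rule sum_mono)
  then show ?thesis
    using assms
    by (simp add: scalar_prod_def lessThan_atLeast0 sum.distrib flip: sum_distrib_left)
qed

lemma scalar_prod_Cauchy_Schwarz:
  fixes v w :: "real vec"
  assumes "v \<in> carrier_vec n" "w \<in> carrier_vec n"
  shows "(v \<bullet> w)\<^sup>2 \<le> (v \<bullet> v) * (w \<bullet> w)"
  using Cauchy_Schwarz_ineq_sum[of "\<lambda>i. v $ i" "\<lambda>i. w $ i" "{0..<n}"] assms
  by (simp add: scalar_prod_def power2_eq_square)

text \<open>Cauchy-Schwarz in every row: the squared Frobenius norm is an admissible
  constant.\<close>

lemma mult_mat_vec_bounded:
  fixes A :: "real mat"
  assumes A: "A \<in> carrier_mat m n"
  obtains C where "0 < C"
    "\<And>v. v \<in> carrier_vec n \<Longrightarrow> (A *\<^sub>v v) \<bullet> (A *\<^sub>v v) \<le> C * (v \<bullet> v)"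
proof
  define C where "C = (\<Sum>i\<in>{0..<m}. row A i \<bullet> row A i)"
  have "0 \<le> C"
    unfolding C_def by (intro sum_nonneg scalar_prod_self_nonneg)
  \<comment> \<open>The added 1 keeps the constant positive for a zero or empty matrix.\<close>
  then show "0 < C + 1" by simp
  fix v :: "real vec" assume v: "v \<in> carrier_vec n"
  have "(A *\<^sub>v v) \<bullet> (A *\<^sub>v v) = (\<Sum>i\<in>{0..<m}. (row A i \<bullet> v)\<^sup>2)"
    using A by (simp add: scalar_prod_def[of "A *\<^sub>v v"] power2_eq_square)
  also have "\<dots> \<le> (\<Sum>i\<in>{0..<m}. (row A i \<bullet> row A i) * (v \<bullet> v))"
    by (intro sum_mono scalar_prod_Cauchy_Schwarz[of _ n]) (use A v in auto)
  also have "\<dots> = C * (v \<bullet> v)"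
    by (simp add: C_def sum_distrib_right)
  also have "\<dots> \<le> (C + 1) * (v \<bullet> v)"
    by (intro mult_right_mono scalar_prod_self_nonneg) simp
  finally show "(A *\<^sub>v v) \<bullet> (A *\<^sub>v v) \<le> (C + 1) * (v \<bullet> v)" .
qed

text \<open>With w = Bv, invertibility bounds |v|^2 by a multiple of |w|^2, and semidefiniteness
  tested at a vector v - tw bounds |w|^2 by a multiple of the form at v. Chaining the two gives c =
  1/(KD).\<close>

lemma psd_nonsingular_coercive:
  fixes B :: "real mat"
  assumes B: "B \<in> carrier_mat n n" and sym: "transpose_mat B = B"
    and psd: "\<And>v. v \<in> carrier_vec n \<Longrightarrow> 0 \<le> v \<bullet> (B *\<^sub>v v)"
    and det: "det B \<noteq> 0"
  obtains c where "0 < c" "\<And>v. v \<in> carrier_vec n \<Longrightarrow> c * (v \<bullet> v) \<le> v \<bullet> (B *\<^sub>v v)"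
proof -
  obtain B' where B': "B' \<in> carrier_mat n n" and inv: "B' * B = 1\<^sub>m n"
    \<comment> \<open>\<open>()\<close> merely fills the record extension of the matrix ring;
      membership in its units yields a left inverse.\<close>
    using det_non_zero_imp_unit[OF B det, of "()"] unfolding Units_def ring_mat_def by auto
  obtain C where C: "0 < C"
    "\<And>v. v \<in> carrier_vec n \<Longrightarrow> (B *\<^sub>v v) \<bullet> (B *\<^sub>v v) \<le> C * (v \<bullet> v)"
    using mult_mat_vec_bounded[OF B] by blast
  obtain D where D: "0 < D"
    "\<And>v. v \<in> carrier_vec n \<Longrightarrow> (B' *\<^sub>v v) \<bullet> (B' *\<^sub>v v) \<le> D * (v \<bullet> v)"
    using mult_mat_vec_bounded[OF B'] by blast
  \<comment> \<open>The constant in \<open>wBw\<close>: 2 w \<bullet> Bw \<le> |w|^2 + |Bw|^2 \<le>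
    (1 + C) |w|^2.\<close>
  define K where "K = (1 + C) / 2"
  have K: "0 < K" using C(1) by (simp add: K_def)
  show thesis
  proof (rule that)
    show "0 < 1 / (K * D)" using K D(1) by simp
    fix v :: "real vec" assume v: "v \<in> carrier_vec n"
    define w where "w = B *\<^sub>v v"
    have w: "w \<in> carrier_vec n" and Bw: "B *\<^sub>v w \<in> carrier_vec n"
      using B v by (auto simp: w_def)
    have "B' *\<^sub>v w = v"
      unfolding w_def by (metis B B' inv v assoc_mult_mat_vec one_mult_mat_vec)
    then have vw: "v \<bullet> v \<le> D * (w \<bullet> w)"
      using D(2)[OF w] by simp
    have wBw: "w \<bullet> (B *\<^sub>v w) \<le> K * (w \<bullet> w)"
      using scalar_prod_le_half_squares[OF w Bw] C(2)[OF w] by (simp add: K_def field_simps)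
    \<comment> \<open>Nonnegativity of the form at \<open>v - t \<cdot>\<^sub>v w\<close>, where the choice of \<open>t\<close> minimises the upper bound
      \<open>v \<bullet> w - 2 * t * (w \<bullet> w) + t * t * K * (w \<bullet> w)\<close>.\<close>
    define t where "t = 1 / K"
    define u where "u = v - t \<cdot>\<^sub>v w"
    have u: "u \<in> carrier_vec n" using v w by (simp add: u_def)
    have Bu: "B *\<^sub>v u = w - t \<cdot>\<^sub>v (B *\<^sub>v w)"
      unfolding u_def using B v w by (simp add: mult_minus_distrib_mat_vec w_def[symmetric] mult_mat_vec)
    have vBw: "v \<bullet> (B *\<^sub>v w) = w \<bullet> w"
      using transpose_vec_mult_scalar[OF B w v] sym by (simp add: w_def)
    have "0 \<le> u \<bullet> (B *\<^sub>v u)" by (rule psd[OF u])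
    also have "u \<bullet> (B *\<^sub>v u) = u \<bullet> w - t * (u \<bullet> (B *\<^sub>v w))"
      unfolding Bu using u w Bw by (subst scalar_prod_minus_distrib[of _ n]) auto
    also have "\<dots> = v \<bullet> w - t * (w \<bullet> w) - t * (w \<bullet> w - t * (w \<bullet> (B *\<^sub>v w)))"
      unfolding u_def using v w Bw 
      by (simp add: minus_scalar_prod_distrib[of _ n] vBw)
    also have "\<dots> = v \<bullet> w - 2 * t * (w \<bullet> w) + t * t * (w \<bullet> (B *\<^sub>v w))"
      by (simp add: algebra_simps)
    also have "\<dots> \<le> v \<bullet> w - 2 * t * (w \<bullet> w) + t * t * (K * (w \<bullet> w))"
      using mult_left_mono[OF wBw, of "t * t"] by simp
    also have "\<dots> = v \<bullet> w - (w \<bullet> w) / K"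
      using K by (simp add: t_def field_simps)
    finally have "(w \<bullet> w) / K \<le> v \<bullet> w" by simp
    moreover have "1 / (K * D) * (v \<bullet> v) \<le> (w \<bullet> w) / K"
      using vw K D(1) by (simp add: field_simps)
    ultimately show "1 / (K * D) * (v \<bullet> v) \<le> v \<bullet> (B *\<^sub>v v)"
      by (simp add: w_def)
  qed
qed

text \<open>The infimum \<open>\<mu>\<close> of the Rayleigh quotient satisfies the inequality by
  construction, and it lies in the spectrum, so the minimum of the spectrum is at most
  \<open>\<mu>\<close>.\<close>

lemma Min_spectrum_le_quadratic_form:
  fixes A :: "real mat"
  assumes A: "A \<in> carrier_mat n n" and sym: "transpose_mat A = A"
    and v: "v \<in> carrier_vec n"
  shows "Min (spectrum A) * (v \<bullet> v) \<le> v \<bullet> (A *\<^sub>v v)"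
\<comment> \<open>A nonzero \<open>v\<close> is needed for the set of quotients to be nonempty; this
  split also disposes of n = 0.\<close>
proof (cases "v = 0\<^sub>v n")
  case True
  then show ?thesis using A by simp
next
  case False
  let ?q = "\<lambda>u. u \<bullet> (A *\<^sub>v u) / (u \<bullet> u)"
  define R where "R = ?q ` (carrier_vec n - {0\<^sub>v n})"
  define \<mu> where "\<mu> = Inf R"
  have "R \<noteq> {}" using v False by (auto simp: R_def)
  obtain C where C: "0 < C"
    "\<And>v. v \<in> carrier_vec n \<Longrightarrow> (A *\<^sub>v v) \<bullet> (A *\<^sub>v v) \<le> C * (v \<bullet> v)"
    using mult_mat_vec_bounded[OF A] by blast
  have "bdd_below R"
  proof (rule bdd_belowI)
    fix r assume "r \<in> R"
    then obtain u where u: "u \<in> carrier_vec n" "u \<noteq> 0\<^sub>v n" and r: "r = ?q u"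
      by (auto simp: R_def)
    \<comment> \<open>The sign on \<open>u\<close> turns an upper estimate into a lower bound for
      the quotient.\<close>
    have "2 * (- u \<bullet> (A *\<^sub>v u)) \<le> - u \<bullet> - u + (A *\<^sub>v u) \<bullet> (A *\<^sub>v u)"
      by (rule scalar_prod_le_half_squares[of _ n]) (use A u in auto)
    also have "\<dots> \<le> (1 + C) * (u \<bullet> u)"
      using C(2)[OF u(1)] u by (simp add: algebra_simps)
    finally show "- (1 + C) / 2 \<le> r"
      using scalar_prod_self_pos[OF u] A u by (simp add: r field_simps)
  qed
  have le: "\<mu> * (u \<bullet> u) \<le> u \<bullet> (A *\<^sub>v u)" if u: "u \<in> carrier_vec n" for u
  proof (cases "u = 0\<^sub>v n")
    case True
    then show ?thesis using A by simp
  next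
    case False
    have "\<mu> \<le> ?q u"
      unfolding \<mu>_def by (rule cInf_lower[OF _ \<open>bdd_below R\<close>]) (use u False in \<open>auto simp: R_def\<close>)
    then show ?thesis
      using scalar_prod_self_pos[OF u False] by (simp add: field_simps)
  qed
  \<comment> \<open>This is A - \<mu> I, singular exactly when \<open>\<mu>\<close> is an
    eigenvalue.\<close>
  define B where "B = char_matrix A \<mu>"
  have B: "B \<in> carrier_mat n n" using A by (simp add: B_def)
  have symB: "transpose_mat B = B"
  proof (rule eq_matI)
    fix i j assume "i < dim_row B" "j < dim_col B"
    moreover have "A $$ (j, i) = A $$ (i, j)" if "i < n" "j < n"
      using that A arg_cong[OF sym, of "\<lambda>M. M $$ (i, j)"] by simp
    ultimately show "transpose_mat B $$ (i, j) = B $$ (i, j)"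
      using A B by (auto simp: B_def char_matrix_def)
  qed (use B in auto)
  have form: "u \<bullet> (B *\<^sub>v u) = u \<bullet> (A *\<^sub>v u) - \<mu> * (u \<bullet> u)" if u: "u \<in> carrier_vec n" for u
  proof -
    have "B *\<^sub>v u = A *\<^sub>v u + (- \<mu>) \<cdot>\<^sub>v u"
      unfolding B_def char_matrix_def using A u
      by (subst add_mult_distrib_mat_vec[of _ n n]) auto
    then show ?thesis
      using A u by (simp add: scalar_prod_add_distrib[of _ n])
  qed
  have "\<mu> \<in> spectrum A"
  proof (rule ccontr)
    assume "\<mu> \<notin> spectrum A"
    then have "det B \<noteq> 0"
      using A by (simp add: B_def spectrum_def eigenvalue_det)
    moreover have "0 \<le> u \<bullet> (B *\<^sub>v u)" if "u \<in> carrier_vec n" for u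
      using le[OF that] form[OF that] by simp
    ultimately obtain c where c: "0 < c"
      "\<And>u. u \<in> carrier_vec n \<Longrightarrow> c * (u \<bullet> u) \<le> u \<bullet> (B *\<^sub>v u)"
      using psd_nonsingular_coercive[OF B symB] by blast
    \<comment> \<open>Coercivity raises the lower bound on every quotient from \<open>\<mu>\<close>
      to \<open>\<mu> + c\<close>.\<close>
    have "\<mu> + c \<le> Inf R"
    proof (rule cInf_greatest[OF \<open>R \<noteq> {}\<close>])
      fix r assume "r \<in> R"
      then obtain u where u: "u \<in> carrier_vec n" "u \<noteq> 0\<^sub>v n" and r: "r = ?q u"
        by (auto simp: R_def)
      show "\<mu> + c \<le> r"
        using c(2)[OF u(1)] form[OF u(1)] scalar_prod_self_pos[OF u]
        by (simp add: r field_simps)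
    qed
    then show False using c(1) by (simp add: \<mu>_def)
  qed
  \<comment> \<open>Finiteness of the spectrum makes \<open>Min\<close> a genuine lower bound for
    it.\<close>
  then have "Min (spectrum A) \<le> \<mu>"
    using card_finite_spectrum(1)[OF A] by simp
  then have "Min (spectrum A) * (v \<bullet> v) \<le> \<mu> * (v \<bullet> v)"
    by (rule mult_right_mono[OF _ scalar_prod_self_nonneg])
  also have "\<dots> \<le> v \<bullet> (A *\<^sub>v v)" by (rule le[OF v])
  finally show ?thesis .
qed

section \<open>Passage from matrices and integrals to sums over index sets\<close>

text \<open>\<open>submatrix\<close> addresses its entries through \<open>pick\<close>, so sums over
  positions must become sums over \<open>S\<close>. Strict monotonicity gives injectivity, and
  counting then gives surjectivity.\<close>

lemma bij_betw_pick:
  assumes "finite S"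
  shows "bij_betw (pick S) {0..<card S} S"
proof (rule bij_betw_imageI)
  show inj: "inj_on (pick S) {0..<card S}"
    by (rule linorder_inj_onI') (metis atLeastLessThan_iff less_irrefl pick_mono_le)
  show "pick S ` {0..<card S} = S"
    by (rule card_subset_eq[OF assms]) (use inj in \<open>auto simp: card_image pick_in_set_le\<close>)
qed

text \<open>The product is dominated by the integrable function f^2 + g^2.\<close>

lemma integrable_mult_L2:
  assumes "in_L2 Q f" "in_L2 Q g"
  shows "integrable Q (\<lambda>x. f x * g x)"
proof (rule Bochner_Integration.integrable_bound)
  show "integrable Q (\<lambda>x. (f x)\<^sup>2 + (g x)\<^sup>2)"
    using assms by (simp add: in_L2_def)
  show "(\<lambda>x. f x * g x) \<in> borel_measurable Q"
    using assms by (auto simp: in_L2_def intro: borel_measurable_times)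
  have "\<bar>a * b\<bar> \<le> a\<^sup>2 + b\<^sup>2" for a b :: real
    using sum_squares_bound[of "\<bar>a\<bar>" "\<bar>b\<bar>"] abs_ge_zero[of "a * b"]
    unfolding power2_abs mult.assoc abs_mult[symmetric] by linarith
  then show "AE x in Q. norm (f x * g x) \<le> norm ((f x)\<^sup>2 + (g x)\<^sup>2)"
    by simp
qed

lemma L2_inner_lin_comb:
  assumes L2: "\<And>j. j < p \<Longrightarrow> in_L2 Q (\<psi> j)"
    and "\<beta> \<in> carrier_vec p" "\<gamma> \<in> carrier_vec p"
  shows "L2_inner Q (lin_comb \<psi> \<beta>) (lin_comb \<psi> \<gamma>) =
    (\<Sum>j<p. \<Sum>k<p. \<beta> $ j * \<gamma> $ k * gram Q p \<psi> $$ (j, k))"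
proof -
  have "lin_comb \<psi> \<beta> x * lin_comb \<psi> \<gamma> x =
      (\<Sum>j<p. \<Sum>k<p. \<beta> $ j * \<gamma> $ k * (\<psi> j x * \<psi> k x))" for x
    using assms(2,3) by (simp add: lin_comb_def sum_product mult_ac)
  then have "L2_inner Q (lin_comb \<psi> \<beta>) (lin_comb \<psi> \<gamma>) =
      (\<integral>x. (\<Sum>j<p. \<Sum>k<p. \<beta> $ j * \<gamma> $ k * (\<psi> j x * \<psi> k x)) \<partial>Q)"
    by (simp add: L2_inner_def)
  also have "\<dots> = (\<Sum>j<p. \<Sum>k<p. \<beta> $ j * \<gamma> $ k * (\<integral>x. \<psi> j x * \<psi> k x \<partial>Q))"
    \<comment> \<open>The outer sum is exchanged first, which requires integrability of the inner
      sums; the simplifier then exchanges the inner ones.\<close>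
    by (subst Bochner_Integration.integral_sum;
        (intro Bochner_Integration.integrable_sum)?;
        (simp add: Bochner_Integration.integral_sum integrable_mult_L2 L2)?)
  finally show ?thesis
    by (simp add: gram_def L2_inner_def)
qed

text \<open>Serves both the denominator, with M = N = S, and the numerator, with \<open>S\<close>
  and its complement.\<close>

lemma L2_inner_lin_comb_restrict:
  assumes L2: "\<And>j. j < p \<Longrightarrow> in_L2 Q (\<psi> j)"
    and \<beta>: "\<beta> \<in> carrier_vec p" and "M \<subseteq> {..<p}" "N \<subseteq> {..<p}"
  shows "L2_inner Q (lin_comb \<psi> (restrict_vec \<beta> M)) (lin_comb \<psi> (restrict_vec \<beta> N)) =
    (\<Sum>j\<in>M. \<Sum>k\<in>N. \<beta> $ j * \<beta> $ k * gram Q p \<psi> $$ (j, k))"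
proof -
  have "L2_inner Q (lin_comb \<psi> (restrict_vec \<beta> M)) (lin_comb \<psi> (restrict_vec \<beta> N)) =
    (\<Sum>j<p. \<Sum>k<p. restrict_vec \<beta> M $ j * restrict_vec \<beta> N $ k * gram Q p \<psi> $$ (j, k))"
    by (rule L2_inner_lin_comb[OF L2]) (use \<beta> in \<open>auto simp: restrict_vec_def\<close>)
  also have "\<dots> = (\<Sum>j<p. if j \<in> M then
      (\<Sum>k<p. if k \<in> N then \<beta> $ j * \<beta> $ k * gram Q p \<psi> $$ (j, k) else 0) else 0)"
    using \<beta> by (intro sum.cong) (auto simp: restrict_vec_def intro!: sum.cong)
  also have "\<dots> = (\<Sum>j\<in>M. \<Sum>k\<in>N. \<beta> $ j * \<beta> $ k * gram Q p \<psi> $$ (j, k))"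
    using assms(3,4) by (simp add: sum.inter_restrict[symmetric] Int_absorb1)
  finally show ?thesis .
qed

lemma vec_norm1_restrict_vec:
  assumes "\<beta> \<in> carrier_vec p" "N \<subseteq> {..<p}"
  shows "vec_norm1 (restrict_vec \<beta> N) = (\<Sum>j\<in>N. \<bar>\<beta> $ j\<bar>)"
proof -
  have "vec_norm1 (restrict_vec \<beta> N) = (\<Sum>j<p. if j \<in> N then \<bar>\<beta> $ j\<bar> else 0)"
    using assms(1) by (auto simp: vec_norm1_def restrict_vec_def intro!: sum.cong)
  then show ?thesis
    using assms(2) by (simp add: sum.inter_restrict[symmetric] Int_absorb1)
qed

lemma vec_norm2_restrict_vec:
  assumes "\<beta> \<in> carrier_vec p" "N \<subseteq> {..<p}"
  shows "vec_norm2 (restrict_vec \<beta> N) = sqrt (\<Sum>j\<in>N. (\<beta> $ j)\<^sup>2)"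
proof -
  have "vec_norm2 (restrict_vec \<beta> N) = sqrt (\<Sum>j<p. if j \<in> N then (\<beta> $ j)\<^sup>2 else 0)"
    using assms(1) by (auto simp: vec_norm2_def restrict_vec_def intro!: sum.cong)
  then show ?thesis
    using assms(2) by (simp add: sum.inter_restrict[symmetric] Int_absorb1)
qed

lemma max_over_upper: "finite A \<Longrightarrow> j \<in> A \<Longrightarrow> f j \<le> max_over A f"
  by (auto simp: max_over_def)

lemma max_over_nonneg:
  assumes "finite A" "\<And>j. j \<in> A \<Longrightarrow> 0 \<le> f j"
  shows "0 \<le> max_over A f"
proof (cases "A = {}")
  case False
  then obtain j where "j \<in> A" by auto
  then show ?thesis
    using assms max_over_upper[of A j f] by fastforce
qed (simp add: max_over_def)

lemma max_over_le_mult_max_over: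
  assumes "finite A" "\<And>j. j \<in> A \<Longrightarrow> f j \<le> c * g j" "0 \<le> c"
  shows "max_over A f \<le> c * max_over A g"
\<comment> \<open>On the empty set both maxima take the default value 0.\<close>
proof (cases "A = {}")
  case False
  have "f j \<le> c * max_over A g" if "j \<in> A" for j
    using assms that max_over_upper[of A j g] mult_left_mono[of "g j" "max_over A g" c] by fastforce
  then show ?thesis
    using False assms(1) by (simp add: max_over_def[of A f])
qed (simp add: max_over_def)

section \<open>Bounds for the denominator and the numerator\<close>

text \<open>The Rayleigh principle for the Gram submatrix on \<open>S\<close>, at the vector of
  entries of \<open>\<beta>\<close> picked along \<open>S\<close>.\<close>

lemma Lambda2_le_L2_norm_restrict:
  assumes L2: "\<And>j. j < p \<Longrightarrow> in_L2 Q (\<psi> j)"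
    and \<beta>: "\<beta> \<in> carrier_vec p" and S: "S \<subseteq> {..<p}"
  shows "Lambda2 Q p \<psi> S * (vec_norm2 (restrict_vec \<beta> S))\<^sup>2
    \<le> (L2_norm Q (lin_comb \<psi> (restrict_vec \<beta> S)))\<^sup>2"
proof -
  let ?G = "gram Q p \<psi>"
  define A where "A = submatrix ?G S S"
  define v where "v = vec (card S) (\<lambda>i. \<beta> $ pick S i)"
  have fin: "finite S" using S finite_subset by blast
  \<comment> \<open>\<open>submatrix\<close> takes its dimensions from sets of this form, so both
    equal \<open>card S\<close>.\<close>
  have S_eq: "{i. i < p \<and> i \<in> S} = S" using S by auto
  have pick_S: "i < card S \<Longrightarrow> pick S i \<in> S" for i by (rule pick_in_set_le)
  have pick_p: "i < card S \<Longrightarrow> pick S i < p" for i using pick_S S by auto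
  have A: "A \<in> carrier_mat (card S) (card S)"
    by (simp add: A_def submatrix_def gram_def S_eq)
  have A_index: "A $$ (i, j) = ?G $$ (pick S i, pick S j)" if "i < card S" "j < card S" for i j
    using that by (simp add: A_def submatrix_def gram_def S_eq)
  have sym: "transpose_mat A = A"
    using A by (intro eq_matI)
      (auto simp: A_index gram_def pick_p L2_inner_def mult.commute)
  have v: "v \<in> carrier_vec (card S)" by (simp add: v_def)
  have reindex: "(\<Sum>i\<in>{0..<card S}. g (pick S i)) = sum g S" for g :: "nat \<Rightarrow> real"
    by (rule sum.reindex_bij_betw[OF bij_betw_pick[OF fin]])
  have "v \<bullet> v = (\<Sum>i\<in>{0..<card S}. (\<beta> $ pick S i)\<^sup>2)"
    by (simp add: v_def scalar_prod_def power2_eq_square)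
  also have "\<dots> = (vec_norm2 (restrict_vec \<beta> S))\<^sup>2"
    by (simp add: reindex[of "\<lambda>j. (\<beta> $ j)\<^sup>2"] vec_norm2_restrict_vec[OF \<beta> S] sum_nonneg)
  finally have vv: "v \<bullet> v = (vec_norm2 (restrict_vec \<beta> S))\<^sup>2" .
  have "v \<bullet> (A *\<^sub>v v) = (\<Sum>i\<in>{0..<card S}. \<Sum>j\<in>{0..<card S}.
      \<beta> $ pick S i * \<beta> $ pick S j * ?G $$ (pick S i, pick S j))"
    using A by (simp add: scalar_prod_def v_def A_index sum_distrib_left mult_ac)
  also have "\<dots> = (\<Sum>j\<in>S. \<Sum>k\<in>S. \<beta> $ j * \<beta> $ k * ?G $$ (j, k))"
    by (simp add: reindex[of "\<lambda>k. \<beta> $ j * \<beta> $ k * ?G $$ (j, k)" for j]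
        reindex[of "\<lambda>j. \<Sum>k\<in>S. \<beta> $ j * \<beta> $ k * ?G $$ (j, k)"])
  also have "\<dots> = L2_inner Q (lin_comb \<psi> (restrict_vec \<beta> S)) (lin_comb \<psi> (restrict_vec \<beta> S))"
    by (rule L2_inner_lin_comb_restrict[OF L2 \<beta> S S, symmetric])
  also have "\<dots> = (L2_norm Q (lin_comb \<psi> (restrict_vec \<beta> S)))\<^sup>2"
    by (simp add: L2_norm_def L2_inner_def)
  finally have "v \<bullet> (A *\<^sub>v v) = (L2_norm Q (lin_comb \<psi> (restrict_vec \<beta> S)))\<^sup>2" .
  then show ?thesis
    using Min_spectrum_le_quadratic_form[OF A sym v] vv by (simp add: Lambda2_def A_def)
qed

text \<open>Hoelder duality between the 1-norm and the maximum over \<open>T\<close>, after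
  Cauchy-Schwarz over \<open>S\<close> for each fixed index of \<open>T\<close>.\<close>

lemma abs_L2_inner_restrict_le:
  assumes L2: "\<And>j. j < p \<Longrightarrow> in_L2 Q (\<psi> j)"
    and \<beta>: "\<beta> \<in> carrier_vec p" and S: "S \<subseteq> {..<p}" and T: "T \<subseteq> {..<p}"
  shows "\<bar>L2_inner Q (lin_comb \<psi> (restrict_vec \<beta> S)) (lin_comb \<psi> (restrict_vec \<beta> T))\<bar>
    \<le> vec_norm1 (restrict_vec \<beta> T) * vec_norm2 (restrict_vec \<beta> S)
        * max_over T (\<lambda>j. sqrt (\<Sum>k\<in>S. (gram Q p \<psi> $$ (j, k))\<^sup>2))"
proof -
  let ?G = "gram Q p \<psi>"
  define M where "M = max_over T (\<lambda>j. sqrt (\<Sum>k\<in>S. (?G $$ (j, k))\<^sup>2))"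
  let ?b = "vec_norm2 (restrict_vec \<beta> S)"
  have b: "?b = sqrt (\<Sum>j\<in>S. (\<beta> $ j)\<^sup>2)" by (rule vec_norm2_restrict_vec[OF \<beta> S])
  have col: "\<bar>\<Sum>k\<in>S. \<beta> $ k * ?G $$ (j, k)\<bar> \<le> ?b * M" if "j \<in> T" for j
  proof -
    have "\<bar>\<Sum>k\<in>S. \<beta> $ k * ?G $$ (j, k)\<bar> = sqrt ((\<Sum>k\<in>S. \<beta> $ k * ?G $$ (j, k))\<^sup>2)"
      by simp
    also have "\<dots> \<le> ?b * sqrt (\<Sum>k\<in>S. (?G $$ (j, k))\<^sup>2)"
      unfolding b real_sqrt_mult[symmetric]
      by (rule real_sqrt_le_mono[OF Cauchy_Schwarz_ineq_sum])
    also have "\<dots> \<le> ?b * M"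
      unfolding M_def using that T finite_subset[OF T]
      by (intro mult_left_mono max_over_upper[of T j "\<lambda>j. sqrt (\<Sum>k\<in>S. (?G $$ (j, k))\<^sup>2)"])
        (auto simp: b sum_nonneg)
    finally show ?thesis .
  qed
  \<comment> \<open>Swapping the arguments puts \<open>T\<close> in the outer sum, so that the inner
    sum runs along row \<open>j\<close> of the Gram matrix.\<close>
  have "L2_inner Q (lin_comb \<psi> (restrict_vec \<beta> S)) (lin_comb \<psi> (restrict_vec \<beta> T)) =
      L2_inner Q (lin_comb \<psi> (restrict_vec \<beta> T)) (lin_comb \<psi> (restrict_vec \<beta> S))"
    by (simp add: L2_inner_def mult.commute)
  also have "\<dots> = (\<Sum>j\<in>T. \<beta> $ j * (\<Sum>k\<in>S. \<beta> $ k * ?G $$ (j, k)))"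
    by (simp add: L2_inner_lin_comb_restrict[OF L2 \<beta> T S] sum_distrib_left mult_ac)
  also have "\<bar>\<dots>\<bar> \<le> (\<Sum>j\<in>T. \<bar>\<beta> $ j\<bar> * (?b * M))"
    by (rule order_trans[OF sum_abs], rule sum_mono)
      (simp add: abs_mult mult_left_mono col)
  also have "\<dots> = vec_norm1 (restrict_vec \<beta> T) * ?b * M"
    by (simp add: vec_norm1_restrict_vec[OF \<beta> T] sum_distrib_right mult.assoc)
  finally show ?thesis by (simp add: M_def)
qed

section \<open>Assembly of the two inequalities\<close>

theorem corollary4p1:
  fixes Q :: "'a measure" and p :: nat and \<psi> :: "nat \<Rightarrow> 'a \<Rightarrow> real" and S :: "nat set"
  assumes "prob_space Q"
    and "\<And>j. j < p \<Longrightarrow> in_L2 Q (\<psi> j)"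
    and "S \<subseteq> {..<p}" and "S \<noteq> {}"
    and "0 < Lambda2 Q p \<psi> S"
  shows "theta_adaptive Q p \<psi> S
      \<le> ereal (sqrt (real (card S)) * max_over ({..<p} - S) (\<lambda>j. sqrt (\<Sum>k\<in>S. (gram Q p \<psi> $$ (j, k))\<^sup>2))
                / Lambda2 Q p \<psi> S)
    \<and> sqrt (real (card S)) * max_over ({..<p} - S) (\<lambda>j. sqrt (\<Sum>k\<in>S. (gram Q p \<psi> $$ (j, k))\<^sup>2))
        / Lambda2 Q p \<psi> S
      \<le> theta_mutual Q p \<psi> S"
proof
  let ?T = "{..<p} - S" and ?L = "Lambda2 Q p \<psi> S" and ?s = "sqrt (real (card S))"
  let ?row = "\<lambda>j. sqrt (\<Sum>k\<in>S. (gram Q p \<psi> $$ (j, k))\<^sup>2)"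
  let ?ent = "\<lambda>j. max_over S (\<lambda>k. \<bar>gram Q p \<psi> $$ (j, k)\<bar>)"
  define M where "M = max_over ?T ?row"
  \<comment> \<open>This includes the default 0 when \<open>S\<close> is the whole index
    set.\<close>
  have M: "0 \<le> M" unfolding M_def by (rule max_over_nonneg) (simp_all add: sum_nonneg)
  have fin: "finite S" using assms(3) finite_subset by blast
  show "theta_adaptive Q p \<psi> S \<le> ereal (?s * max_over ?T ?row / ?L)"
    unfolding theta_adaptive_def M_def[symmetric]
  proof (rule Sup_least)
    let ?b = "\<lambda>\<beta>. vec_norm2 (restrict_vec \<beta> S)"
    let ?n = "\<lambda>\<beta>. (L2_norm Q (lin_comb \<psi> (restrict_vec \<beta> S)))\<^sup>2"
    let ?i = "\<lambda>\<beta>. \<bar>L2_inner Q (lin_comb \<psi> (restrict_vec \<beta> S)) (lin_comb \<psi> (restrict_vec \<beta> ?T))\<bar>"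
    fix r
    assume "r \<in> {ereal (?i \<beta> / ?n \<beta>) | \<beta>. \<beta> \<in> carrier_vec p \<and> restrict_vec \<beta> S \<noteq> 0\<^sub>v p \<and>
      vec_norm1 (restrict_vec \<beta> ?T) \<le> ?s * ?b \<beta>}"
    then obtain \<beta> where r: "r = ereal (?i \<beta> / ?n \<beta>)"
      and \<beta>: "\<beta> \<in> carrier_vec p" and nz: "restrict_vec \<beta> S \<noteq> 0\<^sub>v p"
      and cone: "vec_norm1 (restrict_vec \<beta> ?T) \<le> ?s * ?b \<beta>"
      by blast
    have b: "0 < ?b \<beta>"
    proof -
      have "0 < restrict_vec \<beta> S \<bullet> restrict_vec \<beta> S"
        by (rule scalar_prod_self_pos[OF _ nz]) (use \<beta> in \<open>simp add: restrict_vec_def\<close>)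
      then show ?thesis
        by (simp add: vec_norm2_def scalar_prod_def power2_eq_square lessThan_atLeast0)
    qed
    have n: "?L * (?b \<beta>)\<^sup>2 \<le> ?n \<beta>" by (rule Lambda2_le_L2_norm_restrict[OF assms(2) \<beta> assms(3)])
    \<comment> \<open>Positivity of \<Lambda>^2 excludes a vanishing denominator, so the quotient
      bound may be cleared by multiplication.\<close>
    have n_pos: "0 < ?n \<beta>" using n b assms(5) by (smt (verit) mult_pos_pos zero_less_power)
    have "?i \<beta> \<le> vec_norm1 (restrict_vec \<beta> ?T) * ?b \<beta> * M"
      unfolding M_def by (rule abs_L2_inner_restrict_le[OF assms(2) \<beta> assms(3)]) auto
    \<comment> \<open>The cone condition trades the 1-norm for a second factor
      \<open>?b \<beta>\<close>, making the bound quadratic in it like the denominator.\<close>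
    also have "\<dots> \<le> ?s * ?b \<beta> * ?b \<beta> * M"
      using b M by (intro mult_right_mono cone) auto
    also have "\<dots> = ?s * M / ?L * (?L * (?b \<beta>)\<^sup>2)"
      using assms(5) by (simp add: power2_eq_square)
    also have "\<dots> \<le> ?s * M / ?L * ?n \<beta>"
      using assms(5) M by (intro mult_left_mono n) auto
    finally show "r \<le> ereal (?s * M / ?L)"
      using n_pos by (simp add: r pos_divide_le_eq)
  qed
  \<comment> \<open>A row has \<open>card S\<close> squared entries, each at most the squared
    maximum; the root of that count is the second factor \<open>?s\<close> needed for the mutual
    bound.\<close>
  have "?row j \<le> ?s * ?ent j" for j
  proof -
    have e: "0 \<le> ?ent j" by (rule max_over_nonneg[OF fin]) simp
    have "(gram Q p \<psi> $$ (j, k))\<^sup>2 \<le> (?ent j)\<^sup>2" if "k \<in> S" for k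
      using max_over_upper[OF fin that, of "\<lambda>k. \<bar>gram Q p \<psi> $$ (j, k)\<bar>"] e
      by (simp add: abs_le_square_iff[symmetric])
    then have "(\<Sum>k\<in>S. (gram Q p \<psi> $$ (j, k))\<^sup>2) \<le> real (card S) * (?ent j)\<^sup>2"
      by (rule sum_bounded_above)
    then have "?row j \<le> sqrt (real (card S) * (?ent j)\<^sup>2)"
      by (rule real_sqrt_le_mono)
    then show ?thesis
      using e by (simp add: real_sqrt_mult)
  qed
  then have "M \<le> ?s * max_over ?T ?ent"
    unfolding M_def by (intro max_over_le_mult_max_over) auto
  then have "?s * M \<le> ?s * (?s * max_over ?T ?ent)"
    by (rule mult_left_mono) simp
  also have "\<dots> = real (card S) * max_over ?T ?ent"
    by (simp flip: mult.assoc)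
  finally show "?s * max_over ?T ?row / ?L \<le> theta_mutual Q p \<psi> S"
    unfolding theta_mutual_def M_def[symmetric]
    using assms(5) by (intro divide_right_mono) auto
qed

end
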